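(* Assume $m_i^0>0$ for all $i$, that there exists $i_0\in\{1,\dots,n\}$ with $\beta_{i_0}^*\ne 1$, and that $$\min\left(\sum_{i=1}^n m_i^0\beta_i^*,\ \sum_{i=1}^n \frac{m_i^0}{\beta_i^*}\right)>1 .$$ Let $(\bar{\boldsymbol c}^s,\bar{\boldsymbol c}^g,\bar X)$ be the unique non-trivial stationary state, and let $\bar{\boldsymbol m}^s=\bar X\,\bar{\boldsymbol c}^s$. Then the state $(\bar{\boldsymbol m}^s,\bar X)\in\mathcal M$ is stable (in the sense of Lyapunov) for the dynamics $$\frac{d}{dt}\boldsymbol m^s(t)=\boldsymbol F(t)$$ on $\mathcal M$.
   Context: Let $\mathcal A=\{(c_1,\dots,c_n)\in\mathbb R_+^n:\ \sum_i c_i=1\}$, let $\boldsymbol\mu^{*,s},\boldsymbol\mu^{*,g}\in\mathbb R^n$ and $\beta_i^*=\exp(\mu_i^{*,g}-\mu_i^{*,s})>0$. Let $\boldsymbol m^0\in\mathcal A$ be the vector of total masses of the $n$ species. Non-trivial stationary state: a triple $(\bar{\boldsymbol c}^s,\bar{\boldsymbol c}^g,\bar X)\in\mathcal A\times\mathcal A\times(0,1)$ such that for all $i$: $\bar X\bar c_i^s+(1-\bar X)\bar c_i^g=m_i^0$ and $\sqrt{\beta_i^*}\,\bar c_i^g-\frac1{\sqrt{\beta_i^*}}\,\bar c_i^s=0$. Under the assumptions of the claim there exists exactly one such triple. Simplified dynamics. The concentrations are uniform in space in each phase. The state space is $$\mathcal M=\Big\{(\boldsymbol m,X)\in\mathbb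 R^{n+1}:\ 0<m_i<m_i^0\ \forall i,\ 0<X<1,\ \sum_{i=1}^n m_i=X\Big\}.$$ For $(\boldsymbol m^s,X)\in\mathcal M$ set $\boldsymbol m^g=\boldsymbol m^0-\boldsymbol m^s$, $c_i^s=m_i^s/X$, $c_i^g=m_i^g/(1-X)$, and $F_i=\sqrt{\beta_i^*}\,c_i^g-\frac{1}{\sqrt{\beta_i^*}}\,c_i^s$, $\boldsymbol F=(F_i)_i$. The dynamics is the ODE $\frac{d}{dt}\boldsymbol m^s(t)=\boldsymbol F(t)$ with $X(t)=\sum_{i=1}^n m_i^s(t)$ (so that $X'=\sum_i F_i$). Lyapunov stability of an equilibrium means: for every neighbourhood $U$ of the equilibrium in $\mathcal M$ there is a neighbourhood $V$ of it in $\mathcal M$ such that every solution starting in $V$ exists for all $t\ge0$ and stays in $U$. *)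

theory Defs
  imports "HOL-Analysis.Analysis"
begin

definition concentrations :: "(real^'n) set" where
  "concentrations = {c. (\<forall>i. 0 \<le> c $ i) \<and> (\<Sum>i\<in>UNIV. c $ i) = 1}"

definition beta :: "real^'n \<Rightarrow> real^'n \<Rightarrow> real^'n" where
  "beta mu_s mu_g = (\<chi> i. exp (mu_g $ i - mu_s $ i))"

definition flux :: "real^'n \<Rightarrow> real^'n \<Rightarrow> real^'n \<Rightarrow> real^'n" where
  "flux b cs cg = (\<chi> i. sqrt (b $ i) * cg $ i - 1 / sqrt (b $ i) * cs $ i)"

definition nontrivial_stationary ::
    "real^'n \<Rightarrow> real^'n \<Rightarrow> real^'n \<Rightarrow> real^'n \<Rightarrow> real \<Rightarrow> bool" where
  "nontrivial_stationary b m0 cs cg X \<longleftrightarrow>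
     cs \<in> concentrations \<and> cg \<in> concentrations \<and> X \<in> {0<..<1} \<and>
     (\<forall>i. X * cs $ i + (1 - X) * cg $ i = m0 $ i) \<and>
     (\<forall>i. flux b cs cg $ i = 0)"

definition state_space :: "real^'n \<Rightarrow> ((real^'n) \<times> real) set" where
  "state_space m0 = {(m, X). (\<forall>i. 0 < m $ i \<and> m $ i < m0 $ i) \<and> 0 < X \<and> X < 1 \<and>
     (\<Sum>i\<in>UNIV. m $ i) = X}"

definition velocity :: "real^'n \<Rightarrow> real^'n \<Rightarrow> (real^'n) \<times> real \<Rightarrow> real^'n" where
  "velocity b m0 = (\<lambda>(ms, X). flux b ((1 / X) *\<^sub>R ms) ((1 / (1 - X)) *\<^sub>R (m0 - ms)))"

(* The state space contains the constraint that X is the sum of the masses, so X needs no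
   equation of its own. At an end point of I the derivative is one-sided. *)
definition solution ::
    "real^'n \<Rightarrow> real^'n \<Rightarrow> (real \<Rightarrow> (real^'n) \<times> real) \<Rightarrow> real set \<Rightarrow> bool" where
  "solution b m0 z I \<longleftrightarrow>
     is_interval I \<and> 0 \<in> I \<and> I \<subseteq> {0..} \<and>
     (\<forall>t\<in>I. z t \<in> state_space m0 \<and>
        ((\<lambda>s. fst (z s)) has_vector_derivative velocity b m0 (z t)) (at t within I))"

definition maximal_solution ::
    "((real \<Rightarrow> 'a) \<Rightarrow> real set \<Rightarrow> bool) \<Rightarrow> (real \<Rightarrow> 'a) \<Rightarrow> real set \<Rightarrow> bool" where
  "maximal_solution sol z I \<longleftrightarrow>
     sol z I \<and> (\<forall>y J. sol y J \<and> I \<subseteq> J \<and> (\<forall>t\<in>I. y t = z t) \<longrightarrow> J = I)"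

definition neighbourhood_in :: "'a::topological_space set \<Rightarrow> 'a \<Rightarrow> 'a set \<Rightarrow> bool" where
  "neighbourhood_in M e U \<longleftrightarrow>
     U \<subseteq> M \<and> (\<exists>W. openin (top_of_set M) W \<and> e \<in> W \<and> W \<subseteq> U)"

(* A solution "exists for all t \<ge> 0" if its maximal extension does; the first conjunct states
   existence separately. *)
definition lyapunov_stable ::
    "((real \<Rightarrow> 'a) \<Rightarrow> real set \<Rightarrow> bool) \<Rightarrow> 'a::topological_space set \<Rightarrow> 'a \<Rightarrow> bool" where
  "lyapunov_stable sol M e \<longleftrightarrow>
     (\<forall>U. neighbourhood_in M e U \<longrightarrow>
       (\<exists>V. neighbourhood_in M e V \<and>
         (\<forall>x\<in>V. (\<exists>z. sol z {0..} \<and> z 0 = x) \<and>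
           (\<forall>z I. maximal_solution sol z I \<and> z 0 = x \<longrightarrow>
              I = {0..} \<and> (\<forall>t\<in>I. z t \<in> U)))))"

end

theory Submission
  imports Defs
begin

text \<open>
  The dynamics decreases the free energy. Since \<open>X\<close> is the total mass \<open>\<Sum> m\<^sub>i\<close> of the solid phase,
  a state is determined by \<open>m\<close>, which ranges over the open box \<open>0 < m\<^sub>i < m0\<^sub>i\<close>, and the dynamics
  is an autonomous ODE there. Up to an additive constant the free energy is
  \<open>V m = X H(c\<^sup>s | C\<^sup>s) + (1 - X) H(c\<^sup>g | C\<^sup>g)\<close>, where \<open>H\<close> is relative entropy and \<open>C\<^sup>s\<close>, \<open>C\<^sup>g\<close>
  are the stationary compositions.

  Dissipation: the partial derivative of \<open>V\<close> in \<open>m\<^sub>i\<close> is \<open>ln (c\<^sup>s\<^sub>i) - ln (\<beta>\<^sub>i c\<^sup>g\<^sub>i)\<close>, whereas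
  \<open>F\<^sub>i\<close> is a positive multiple of \<open>\<beta>\<^sub>i c\<^sup>g\<^sub>i - c\<^sup>s\<^sub>i\<close>. The two have opposite signs because \<open>ln\<close> is
  increasing (\<open>free_energy_dissipation\<close>).

  Strict minimum: by Gibbs' inequality \<open>V \<ge> 0\<close>, and \<open>V = 0\<close> forces both compositions to be the
  stationary ones. The mass balance then determines \<open>X\<close>, because the two stationary compositions
  differ as soon as some \<open>\<beta>\<^sub>i\<close> is not 1 (\<open>free_energy_strict_min\<close>).

  Hence, by Lyapunov's argument, a sublevel set of \<open>V\<close> inside a small ball cannot be left
  (\<open>lyapunov_trapping\<close>). Stability also asserts that solutions exist for all times. On the ball the
  vector field is Lipschitz; composed with the nearest-point projection onto the ball it is globally
  Lipschitz, so that a weighted Picard iteration gives global solutions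
  (\<open>lipschitz_ode_global_existence\<close>), and those that start in the sublevel set never see the
  modification. By uniqueness (\<open>lipschitz_ode_unique\<close>) every maximal solution from there is one
  of these.
\<close>

section \<open>Autonomous differential equations with Lipschitz right-hand side\<close>

definition ode_solution :: "('a::real_normed_vector \<Rightarrow> 'a) \<Rightarrow> (real \<Rightarrow> 'a) \<Rightarrow> real set \<Rightarrow> bool" where
  "ode_solution f y I \<longleftrightarrow> is_interval I \<and> 0 \<in> I \<and> I \<subseteq> {0..} \<and>
     (\<forall>t\<in>I. (y has_vector_derivative f (y t)) (at t within I))"

lemma ode_solution_restrict:
  assumes "ode_solution f y I" "is_interval J" "0 \<in> J" "J \<subseteq> I"
  shows "ode_solution f y J"
  using assms unfolding ode_solution_def
  by (meson has_vector_derivative_within_subset order_trans subsetD)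

lemma ode_solution_initial_segment:
  assumes "ode_solution f y I" "t \<in> I"
  shows "ode_solution f y {0..t}" and "0 \<le> t" and "{0..t} \<subseteq> I"
proof -
  from assms have I: "is_interval I" "0 \<in> I" "I \<subseteq> {0..}" by (auto simp: ode_solution_def)
  show "0 \<le> t" using I assms(2) by auto
  show "{0..t} \<subseteq> I" using I assms(2) by (meson atLeastAtMost_iff mem_is_interval_1_I subsetI)
  with \<open>0 \<le> t\<close> assms(1) show "ode_solution f y {0..t}"
    by (intro ode_solution_restrict[OF assms(1)] is_interval_cc) auto
qed

text \<open>
  The derivative is one-sided at the end points of the interval, so that the lemma applies to
  solutions on any initial segment.
\<close>

lemma nonincreasing_on_Icc:
  fixes \<phi> :: "real \<Rightarrow> real"
  assumes "a \<le> b"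
    and "\<And>t. t \<in> {a..b} \<Longrightarrow> (\<phi> has_vector_derivative \<phi>' t) (at t within {a..b})"
    and "\<And>t. t \<in> {a..b} \<Longrightarrow> \<phi>' t \<le> 0"
  shows "\<phi> b \<le> \<phi> a"
proof -
  obtain t where "t \<in> {a..b}" "\<phi> b - \<phi> a = (b - a) *\<^sub>R \<phi>' t"
    using mvt_very_simple[of a b \<phi> "\<lambda>t h. h *\<^sub>R \<phi>' t"] assms(1,2)
    by (auto simp: has_vector_derivative_def)
  moreover have "(b - a) * \<phi>' t \<le> 0"
    using assms(1) assms(3)[OF \<open>t \<in> {a..b}\<close>] by (simp add: mult_nonneg_nonpos)
  ultimately show ?thesis by simp
qed

text \<open>
  Integration gains the factor \<open>1 / K\<close> in the norm weighted by \<open>exp (- K t)\<close>. For large \<open>K\<close> this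
  makes the Picard operator a contraction on the whole half-line at once, so that no local
  solutions have to be continued.
\<close>

lemma exp_weighted_integral_bound:
  fixes h :: "real \<Rightarrow> 'a::euclidean_space"
  assumes "0 < K" "0 \<le> C" "0 \<le> t" "continuous_on {0..t} h"
    and "\<And>s. s \<in> {0..t} \<Longrightarrow> norm (h s) \<le> C * exp (K * s)"
  shows "exp (- K * t) * norm (integral {0..t} h) \<le> C / K"
proof -
  have I: "((\<lambda>s. C * exp (K * s)) has_integral (C / K * exp (K * t) - C / K * exp (K * 0))) {0..t}"
    using assms(1,3)
    by (intro fundamental_theorem_of_calculus)
       (auto intro!: derivative_eq_intros
             simp flip: has_real_derivative_iff_has_vector_derivative)
  have "norm (integral {0..t} h) \<le> integral {0..t} (\<lambda>s. C * exp (K * s))"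
    using assms I
    by (intro integral_norm_bound_integral integrable_continuous_real) (auto intro!: continuous_intros)
  also have "\<dots> \<le> C / K * exp (K * t)"
    using integral_unique[OF I] assms(1,2) by simp
  finally have "exp (- K * t) * norm (integral {0..t} h) \<le> exp (- K * t) * (C / K * exp (K * t))"
    by (intro mult_left_mono) auto
  also have "\<dots> = C / K" by (simp add: exp_minus)
  finally show ?thesis .
qed

text \<open>
  The weighted space of functions is represented by writing a candidate solution as
  \<open>exp (K t) u(t)\<close> with \<open>u\<close> bounded and continuous. In terms of \<open>u\<close> the Picard operator is a
  contraction with factor \<open>L / K\<close>, and \<open>K = L + 1\<close> is large enough.
\<close>

lemma lipschitz_ode_global_existence:
  fixes g :: "'a::euclidean_space \<Rightarrow> 'a"
  assumes lip: "L-lipschitz_on UNIV g"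
  shows "\<exists>y. ode_solution g y {0..} \<and> y 0 = x0"
proof -
  define K where "K = L + 1"
  have L0: "0 \<le> L" and K0: "0 < K"
    using lipschitz_on_nonneg[OF lip] by (auto simp: K_def)
  have gcont: "continuous_on UNIV g"
    using lip by (rule lipschitz_on_continuous_on)
  define h where "h u s = g (exp (K * s) *\<^sub>R apply_bcontfun u s)" for u :: "real \<Rightarrow>\<^sub>C 'a" and s
  define Q where "Q u t = exp (- K * t) *\<^sub>R (x0 + integral {0..t} (h u))" for u t
  have hcont: "continuous_on A (h u)" for A u
    unfolding h_def
    by (rule continuous_on_compose2[OF gcont]) (auto intro!: continuous_intros)
  have deriv: "((\<lambda>t. integral {0..t} (h u)) has_vector_derivative h u t) (at t within {0..})"
    if "0 \<le> t" for u t
  proof -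
    have "((\<lambda>t. integral {0..t} (h u)) has_vector_derivative h u t) (at t within {0..t+1})"
      using that by (intro integral_has_vector_derivative hcont) auto
    moreover have "at t within {0..t+1} = at t within {0..}"
      by (rule at_within_nhd[of _ "{..<t+1}"]) auto
    ultimately show ?thesis by simp
  qed
  have Qcont: "continuous_on {0..} (Q u)" for u
  proof -
    have "continuous_on {0..} (\<lambda>t. integral {0..t} (h u))"
      by (rule continuous_on_vector_derivative) (use deriv in auto)
    then show ?thesis
      unfolding Q_def by (intro continuous_intros)
  qed
  have Qbound: "norm (Q u t) \<le> norm x0 + (norm (g 0) + L * norm u) / K" if "0 \<le> t" for u t
  proof -
    have "norm (h u s) \<le> (norm (g 0) + L * norm u) * exp (K * s)" if "s \<in> {0..t}" for s
    proof -
      have "norm (h u s) \<le> norm (g 0) + norm (h u s - g 0)"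
        by norm
      also have "norm (h u s - g 0) \<le> L * norm (exp (K * s) *\<^sub>R apply_bcontfun u s)"
        unfolding h_def using lipschitz_on_normD[OF lip UNIV_I UNIV_I, of _ 0] by (metis diff_zero)
      also have "\<dots> \<le> L * (exp (K * s) * norm u)"
        using L0 norm_bounded[of u s] by (auto intro!: mult_left_mono)
      also have "norm (g 0) \<le> norm (g 0) * exp (K * s)"
        using that K0 by (simp add: mult_le_cancel_left1)
      finally show ?thesis by (simp add: algebra_simps)
    qed
    then have "exp (- K * t) * norm (integral {0..t} (h u)) \<le> (norm (g 0) + L * norm u) / K"
      using that K0 L0 by (intro exp_weighted_integral_bound hcont) auto
    moreover have "norm (Q u t) \<le> exp (- K * t) * (norm x0 + norm (integral {0..t} (h u)))"
      unfolding Q_def by (auto intro!: mult_left_mono norm_triangle_ineq)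
    moreover have "exp (- K * t) * norm x0 \<le> norm x0"
      using that K0 by (intro mult_left_le_one_le) auto
    ultimately show ?thesis by (simp add: algebra_simps)
  qed
  \<comment> \<open>Bounded continuous functions live on all of the real line, hence the constant extension to
    negative times.\<close>
  have Qbcont: "(\<lambda>t. Q u (max 0 t)) \<in> bcontfun" for u
  proof (rule bcontfun_normI)
    show "continuous_on UNIV (\<lambda>t. Q u (max 0 t))"
      by (rule continuous_on_compose2[OF Qcont]) (auto intro!: continuous_intros)
  qed (rule Qbound, simp)
  define P where "P u = Bcontfun (\<lambda>t. Q u (max 0 t))" for u
  have P: "apply_bcontfun (P u) t = Q u (max 0 t)" for u t
    unfolding P_def using Qbcont by (simp add: Bcontfun_inverse)
  have "\<exists>!u. P u = u"
  proof (rule banach_fix_type[where c = "L / K"])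
    show "\<forall>u v. dist (P u) (P v) \<le> L / K * dist u v"
    proof (intro allI dist_bound)
      fix u v :: "real \<Rightarrow>\<^sub>C 'a" and t :: real
      define \<tau> where "\<tau> = max 0 t"
      have "norm (h u s - h v s) \<le> L * dist u v * exp (K * s)" for s
      proof -
        have "norm (h u s - h v s)
            \<le> L * norm (exp (K * s) *\<^sub>R apply_bcontfun u s - exp (K * s) *\<^sub>R apply_bcontfun v s)"
          unfolding h_def using lipschitz_on_normD[OF lip] by simp
        also have "\<dots> = L * (exp (K * s) * dist (apply_bcontfun u s) (apply_bcontfun v s))"
          by (simp add: dist_norm flip: scaleR_diff_right)
        also have "\<dots> \<le> L * (exp (K * s) * dist u v)"
          using L0 dist_bounded[of u s v] by (auto intro!: mult_left_mono)
        finally show ?thesis by (simp add: algebra_simps)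
      qed
      then have "exp (- K * \<tau>) * norm (integral {0..\<tau>} (\<lambda>s. h u s - h v s)) \<le> L * dist u v / K"
        using K0 L0
        by (intro exp_weighted_integral_bound continuous_intros hcont) (auto simp: \<tau>_def)
      moreover have "integral {0..\<tau>} (\<lambda>s. h u s - h v s)
          = integral {0..\<tau>} (h u) - integral {0..\<tau>} (h v)"
        by (intro integral_diff integrable_continuous_real hcont)
      then have "dist (Q u \<tau>) (Q v \<tau>)
          = exp (- K * \<tau>) * norm (integral {0..\<tau>} (\<lambda>s. h u s - h v s))"
        by (simp add: Q_def dist_norm flip: scaleR_diff_right)
      ultimately show "dist (apply_bcontfun (P u) t) (apply_bcontfun (P v) t) \<le> L / K * dist u v"
        by (simp add: P flip: \<tau>_def)
    qed
  qed (use K0 L0 in \<open>auto simp: K_def\<close>)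
  then obtain u where u: "P u = u" by blast
  define y where "y t = x0 + integral {0..t} (h u)" for t
  have y: "y t = exp (K * t) *\<^sub>R apply_bcontfun u t" if "0 \<le> t" for t
    using P[of u t] that by (simp add: u Q_def y_def exp_minus)
  have "(y has_vector_derivative g (y t)) (at t within {0..})" if "0 \<le> t" for t
  proof -
    have "(y has_vector_derivative 0 + h u t) (at t within {0..})"
      unfolding y_def by (intro derivative_intros deriv that)
    then show ?thesis by (simp add: h_def y[OF that])
  qed
  moreover have "y 0 = x0" by (simp add: y_def)
  ultimately show ?thesis
    by (auto simp: ode_solution_def is_interval_ci intro!: exI[of _ y])
qed

text \<open>
  Gronwall's argument: \<open>exp (- 2 L t)\<close> times the squared distance of the two solutions is
  nonincreasing and starts at 0.
\<close>

lemma lipschitz_ode_unique: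
  fixes f :: "'a::euclidean_space \<Rightarrow> 'a"
  assumes lip: "L-lipschitz_on S f" and "0 \<le> T" and init: "y 0 = z 0"
    and sol: "ode_solution f y {0..T}" "ode_solution f z {0..T}"
    and S: "y ` {0..T} \<subseteq> S" "z ` {0..T} \<subseteq> S"
  shows "y T = z T"
proof -
  define \<phi> where "\<phi> t = exp (- (2 * L) * t) * ((y t - z t) \<bullet> (y t - z t))" for t
  define \<phi>' where "\<phi>' t = exp (- (2 * L) * t) *
    (2 * ((y t - z t) \<bullet> (f (y t) - f (z t))) - 2 * L * ((y t - z t) \<bullet> (y t - z t)))" for t
  have "\<phi> T \<le> \<phi> 0"
  proof (rule nonincreasing_on_Icc[OF \<open>0 \<le> T\<close>])
    fix t assume t: "t \<in> {0..T}"
    have d: "((\<lambda>t. y t - z t) has_vector_derivative f (y t) - f (z t)) (at t within {0..T})"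
      using sol t by (intro has_vector_derivative_diff) (auto simp: ode_solution_def)
    have "((\<lambda>t. (y t - z t) \<bullet> (y t - z t)) has_real_derivative
        2 * ((y t - z t) \<bullet> (f (y t) - f (z t)))) (at t within {0..T})"
      unfolding has_real_derivative_iff_has_vector_derivative
      using bounded_bilinear.has_vector_derivative[OF bounded_bilinear_inner d d]
      by (simp add: inner_commute)
    then have "(\<phi> has_real_derivative \<phi>' t) (at t within {0..T})"
      unfolding \<phi>_def \<phi>'_def
      by - (rule DERIV_cong, rule DERIV_mult, (rule derivative_eq_intros refl | assumption)+,
            simp add: right_diff_distrib)
    then show "(\<phi> has_vector_derivative \<phi>' t) (at t within {0..T})"
      by (simp add: has_real_derivative_iff_has_vector_derivative)
    have "(y t - z t) \<bullet> (f (y t) - f (z t)) \<le> norm (y t - z t) * norm (f (y t) - f (z t))"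
      by (rule norm_cauchy_schwarz)
    also have "\<dots> \<le> norm (y t - z t) * (L * norm (y t - z t))"
      using S t by (intro mult_left_mono lipschitz_on_normD[OF lip]) auto
    also have "\<dots> = L * ((y t - z t) \<bullet> (y t - z t))"
      by (simp add: dot_square_norm power2_eq_square)
    finally show "\<phi>' t \<le> 0"
      unfolding \<phi>'_def by (auto intro!: mult_nonneg_nonpos)
  qed
  also have "\<phi> 0 = 0" by (simp add: \<phi>_def init)
  finally have "(y T - z T) \<bullet> (y T - z T) \<le> 0"
    by (simp add: \<phi>_def mult_le_0_iff)
  then show ?thesis by (metis inner_ge_zero inner_eq_zero_iff eq_iff_diff_eq_0 antisym)
qed

section \<open>Lyapunov functions\<close>

text \<open>
  At the first time on the sphere, \<open>V\<close> would be at least \<open>a\<close>; but up to that time the solution is in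
  the ball, where \<open>V\<close> cannot grow from its initial value below \<open>a\<close>. The right-hand side \<open>f\<close> is only
  controlled inside the ball, so the lemma also applies after a change of \<open>f\<close> outside it.
\<close>

lemma lyapunov_trapping:
  fixes V :: "'a::real_normed_vector \<Rightarrow> real"
  assumes V: "\<And>x. x \<in> cball p r \<Longrightarrow> (V has_derivative V' x) (at x)"
    and decr: "\<And>x. x \<in> cball p r \<Longrightarrow> V' x (f x) \<le> 0"
    and barrier: "\<And>x. x \<in> sphere p r \<Longrightarrow> a \<le> V x"
    and sol: "ode_solution f z I"
    and start: "z 0 \<in> ball p r" "V (z 0) < a"
    and t: "t \<in> I"
  shows "z t \<in> ball p r"
proof (rule ccontr)
  assume out: "z t \<notin> ball p r"
  note sub = ode_solution_initial_segment(3)[OF sol t]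
  have "0 \<le> t" by (rule ode_solution_initial_segment(2)[OF sol t])
  have z: "(z has_vector_derivative f (z s)) (at s within I)" if "s \<in> I" for s
    using sol that by (simp add: ode_solution_def)
  have cont: "continuous_on {0..t} (\<lambda>s. dist p (z s))"
    by (intro continuous_intros continuous_on_subset[OF continuous_on_vector_derivative[OF z] sub])
  define S where "S = {s \<in> {0..t}. r \<le> dist p (z s)}"
  have "compact S"
    unfolding S_def
    using continuous_closed_preimage[OF cont, of "{r..}"]
    by (auto simp: compact_eq_bounded_closed vimage_def Int_def intro: bounded_subset[of "{0..t}"])
  moreover have "t \<in> S" using \<open>0 \<le> t\<close> out by (auto simp: S_def)
  ultimately obtain T where T: "T \<in> S" and first: "\<And>s. s \<in> S \<Longrightarrow> T \<le> s"
    using compact_attains_inf[of S] by auto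
  have "0 \<le> T" "T \<le> t" using T by (auto simp: S_def)
  have TI: "{0..T} \<subseteq> I" using sub \<open>T \<le> t\<close> by auto
  obtain s where "0 \<le> s" "s \<le> T" "dist p (z s) = r"
    using IVT'[of "\<lambda>s. dist p (z s)" 0 r T] start T \<open>0 \<le> T\<close> \<open>T \<le> t\<close>
      continuous_on_subset[OF cont, of "{0..T}"]
    by (auto simp: S_def)
  then have "s = T" using first[of s] \<open>T \<le> t\<close> by (auto simp: S_def)
  then have hit: "dist p (z T) = r" using \<open>dist p (z s) = r\<close> by simp
  have inside: "z s \<in> cball p r" if "s \<in> {0..T}" for s
    using that first[of s] \<open>T \<le> t\<close> hit by (cases "s = T") (force simp: S_def)+
  have "V (z T) \<le> V (z 0)"
  proof (rule nonincreasing_on_Icc[OF \<open>0 \<le> T\<close>])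
    fix s assume s: "s \<in> {0..T}"
    have "(z has_vector_derivative f (z s)) (at s within {0..T})"
      using has_vector_derivative_within_subset[OF z TI] s TI by auto
    from vector_derivative_diff_chain_within[OF this has_derivative_at_withinI[OF V[OF inside[OF s]]]]
    show "((\<lambda>s. V (z s)) has_vector_derivative V' (z s) (f (z s))) (at s within {0..T})"
      by (simp add: o_def)
    show "V' (z s) (f (z s)) \<le> 0"
      using decr inside[OF s] .
  qed
  with barrier[of "z T"] hit start show False by auto
qed

text \<open>
  The neighbourhood is the part of the ball where \<open>V\<close> is below its minimum over the sphere. It
  contains \<open>p\<close> because \<open>p\<close> is a strict minimum.
\<close>

theorem lyapunov_trapping_neighbourhood:
  fixes f :: "'a::euclidean_space \<Rightarrow> 'a" and V :: "'a \<Rightarrow> real"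
  assumes r: "0 < r"
    and lip: "L-lipschitz_on (cball p r) f"
    and V: "\<And>x. x \<in> cball p r \<Longrightarrow> (V has_derivative V' x) (at x)"
    and decr: "\<And>x. x \<in> cball p r \<Longrightarrow> V' x (f x) \<le> 0"
    and strict: "\<And>x. x \<in> cball p r \<Longrightarrow> x \<noteq> p \<Longrightarrow> V p < V x"
  obtains N where "open N" "p \<in> N"
    and "\<And>x. x \<in> N \<Longrightarrow> \<exists>y. ode_solution f y {0..} \<and> y 0 = x"
    and "\<And>z I. ode_solution f z I \<Longrightarrow> z 0 \<in> N \<Longrightarrow> z ` I \<subseteq> ball p r"
proof -
  have Vcont: "continuous_on (cball p r) V"
    using V has_derivative_at_withinI has_derivative_continuous_on by blast
  obtain q where q: "q \<in> sphere p r" and min: "\<And>x. x \<in> sphere p r \<Longrightarrow> V q \<le> V x"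
    using continuous_attains_inf[of "sphere p r" V]
      continuous_on_subset[OF Vcont sphere_cball] r by auto
  define N where "N = ball p r \<inter> V -` {..<V q}"
  have "open N"
    unfolding N_def
    by (intro continuous_open_preimage continuous_on_subset[OF Vcont]) auto
  have "p \<in> N"
    using strict[of q] q r by (auto simp: N_def)
  have trapped: "z ` I \<subseteq> ball p r"
    if "ode_solution g z I" "z 0 \<in> N" and g: "\<And>x. x \<in> cball p r \<Longrightarrow> g x = f x" for g z I
  proof -
    have "V' x (g x) \<le> 0" if "x \<in> cball p r" for x
      using decr[OF that] g[OF that] by simp
    from lyapunov_trapping[OF V this min \<open>ode_solution g z I\<close>] \<open>z 0 \<in> N\<close>
    show ?thesis unfolding N_def by blast
  qed
  \<comment> \<open>The projection onto the ball is nonexpansive, so \<open>g\<close> is a globally Lipschitz extension of \<open>f\<close>.\<close>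
  define g where "g x = f (closest_point (cball p r) x)" for x
  have g: "g x = f x" if "x \<in> cball p r" for x
    using that by (simp add: g_def closest_point_self)
  have "L-lipschitz_on UNIV g"
  proof (rule lipschitz_onI)
    fix x y
    have "dist (g x) (g y)
        \<le> L * dist (closest_point (cball p r) x) (closest_point (cball p r) y)"
      unfolding g_def using r by (intro lipschitz_onD[OF lip] closest_point_in_set) auto
    also have "\<dots> \<le> L * dist x y"
      using r lipschitz_on_nonneg[OF lip]
      by (intro mult_left_mono closest_point_lipschitz) auto
    finally show "dist (g x) (g y) \<le> L * dist x y" .
  qed (rule lipschitz_on_nonneg[OF lip])
  note global = lipschitz_ode_global_existence[OF this]
  have exist: "\<exists>y. ode_solution f y {0..} \<and> y 0 = x" if "x \<in> N" for x
  proof -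
    obtain y where y: "ode_solution g y {0..}" "y 0 = x"
      using global by blast
    have "y ` {0..} \<subseteq> cball p r"
      using trapped[OF y(1) _ g] y(2) \<open>x \<in> N\<close> ball_subset_cball by blast
    then have "g (y t) = f (y t)" if "0 \<le> t" for t
      using that by (intro g) auto
    then have "ode_solution f y {0..}"
      using y(1) by (simp add: ode_solution_def)
    then show ?thesis using y(2) by blast
  qed
  show thesis
    using that[OF \<open>open N\<close> \<open>p \<in> N\<close> exist trapped[OF _ _ refl]] by blast
qed

section \<open>Lipschitz continuity of quotients and of vector-valued maps\<close>

text \<open>
  The denominator is bounded away from 0 by compactness.
\<close>

lemma lipschitz_on_divide_compact:
  fixes u v :: "'a::metric_space \<Rightarrow> real"
  assumes "compact S" and u: "Lu-lipschitz_on S u" and v: "Lv-lipschitz_on S v"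
    and pos: "\<And>x. x \<in> S \<Longrightarrow> 0 < v x"
  shows "\<exists>L. L-lipschitz_on S (\<lambda>x. u x / v x)"
proof (cases "S = {}")
  case False
  obtain \<delta> where \<delta>: "0 < \<delta>" "\<And>x. x \<in> S \<Longrightarrow> \<delta> \<le> v x"
    using continuous_attains_inf[OF \<open>compact S\<close> False lipschitz_on_continuous_on[OF v]] pos
    by blast
  obtain B where B: "0 < B" "\<And>x. x \<in> S \<Longrightarrow> \<bar>u x\<bar> \<le> B"
    using compact_imp_bounded[OF compact_continuous_image[OF lipschitz_on_continuous_on[OF u] \<open>compact S\<close>]]
    by (auto simp: bounded_pos)
  have "(Lu / \<delta> + B * Lv / (\<delta> * \<delta>))-lipschitz_on S (\<lambda>x. u x / v x)"
  proof (rule lipschitz_onI)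
    fix x y assume S: "x \<in> S" "y \<in> S"
    have vx: "0 < v x" "\<delta> \<le> v x" and vy: "0 < v y" "\<delta> \<le> v y"
      using S pos \<delta> by auto
    have "u x / v x - u y / v y = (u x - u y) / v x + u y * (v y - v x) / (v x * v y)"
      using vx(1) vy(1) by (simp add: field_simps)
    then have "\<bar>u x / v x - u y / v y\<bar> \<le> \<bar>u x - u y\<bar> / v x + \<bar>u y\<bar> * \<bar>v y - v x\<bar> / (v x * v y)"
      using vx vy abs_triangle_ineq[of "(u x - u y) / v x" "u y * (v y - v x) / (v x * v y)"]
      by (simp add: abs_mult)
    also have "\<dots> \<le> (Lu * dist x y) / \<delta> + B * (Lv * dist x y) / (\<delta> * \<delta>)"
      using lipschitz_onD[OF u S] lipschitz_onD[OF v S] B(1) B(2)[OF S(2)] vx vy \<delta>(1) lipschitz_on_nonneg[OF v]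
        lipschitz_on_nonneg[OF u]
      by (intro add_mono frac_le mult_mono mult_nonneg_nonneg) (auto simp: dist_real_def abs_minus_commute intro: less_imp_le)
    finally show "dist (u x / v x) (u y / v y) \<le> (Lu / \<delta> + B * Lv / (\<delta> * \<delta>)) * dist x y"
      by (simp add: dist_real_def algebra_simps add_divide_distrib)
  qed (use \<delta> B lipschitz_on_nonneg[OF u] lipschitz_on_nonneg[OF v] in auto)
  then show ?thesis ..
qed (auto intro: exI[of _ 0])

lemma lipschitz_on_vec:
  fixes f :: "'a::metric_space \<Rightarrow> real^'n"
  assumes "\<And>i. \<exists>L. L-lipschitz_on S (\<lambda>x. f x $ i)"
  shows "\<exists>L. L-lipschitz_on S f"
proof -
  obtain L where L: "\<And>i. (L i)-lipschitz_on S (\<lambda>x. f x $ i)"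
    using assms by metis
  have "(\<Sum>i\<in>UNIV. L i)-lipschitz_on S f"
  proof (rule lipschitz_onI)
    fix x y assume "x \<in> S" "y \<in> S"
    have "dist (f x) (f y) \<le> (\<Sum>i\<in>UNIV. \<bar>(f x - f y) $ i\<bar>)"
      unfolding dist_norm by (rule norm_le_l1_cart)
    also have "\<dots> \<le> (\<Sum>i\<in>UNIV. L i * dist x y)"
      using lipschitz_onD[OF L \<open>x \<in> S\<close> \<open>y \<in> S\<close>] by (intro sum_mono) (simp add: dist_real_def)
    finally show "dist (f x) (f y) \<le> (\<Sum>i\<in>UNIV. L i) * dist x y"
      by (simp add: sum_distrib_right)
  qed (use lipschitz_on_nonneg[OF L] in \<open>auto intro: sum_nonneg\<close>)
  then show ?thesis ..
qed

section \<open>Relative entropy of a vector of masses\<close>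

definition total :: "real^'n \<Rightarrow> real" where
  "total m = (\<Sum>i\<in>UNIV. m $ i)"

lemma bounded_linear_total: "bounded_linear total"
  unfolding total_def by (intro bounded_linear_sum bounded_linear_vec_nth)

lemma total_simps [simp]:
  "total (x - y) = total x - total y" "total (a *\<^sub>R x) = a * total x"
  by (simp_all add: total_def sum_subtractf sum_distrib_left)

text \<open>
  Total mass times the Kullback-Leibler divergence of the composition \<open>a / total a\<close> from \<open>c\<close>. In
  this extensive form it is homogeneous of degree one in \<open>a\<close>, and the total mass need not be a
  separate variable.
\<close>

definition relative_entropy :: "real^'n \<Rightarrow> real^'n \<Rightarrow> real" where
  "relative_entropy c a = (\<Sum>i\<in>UNIV. a $ i * (ln (a $ i) - ln (total a * c $ i)))"

lemma relative_entropy_multiple: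
  assumes "total c = 1"
  shows "relative_entropy c (s *\<^sub>R c) = 0"
  using assms by (simp add: relative_entropy_def)

text \<open>
  The tangent inequality for \<open>ln\<close> at 1, in the form in which Gibbs' inequality follows by summation.
\<close>

lemma ln_quotient_bound:
  fixes a b :: real
  assumes "0 < a" "0 < b"
  shows "a - b \<le> a * (ln a - ln b)" and "a \<noteq> b \<Longrightarrow> a - b < a * (ln a - ln b)"
proof -
  have eq: "a * (ln a - ln b) = - (a * ln (b / a))" "a - b = - (a * (b / a - 1))"
    using assms by (simp_all add: ln_div right_diff_distrib)
  show "a - b \<le> a * (ln a - ln b)"
    unfolding eq using assms ln_le_minus_one[of "b / a"] by simp
  assume "a \<noteq> b"
  then have "ln (b / a) < b / a - 1"
    using assms ln_le_minus_one[of "b / a"] ln_eq_minus_one[of "b / a"] by fastforce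
  then show "a - b < a * (ln a - ln b)"
    unfolding eq using assms by simp
qed

text \<open>
  Gibbs' inequality: \<open>ln_quotient_bound\<close> bounds each summand from below by the difference
  \<open>a\<^sub>i - total a * c\<^sub>i\<close>, and these differences sum to 0.
\<close>

lemma relative_entropy_pos:
  assumes a: "\<And>i. 0 < a $ i" and c: "\<And>i. 0 < c $ i" "total c = 1"
  shows relative_entropy_nonneg: "0 \<le> relative_entropy c a"
    and relative_entropy_strict: "a \<noteq> total a *\<^sub>R c \<Longrightarrow> 0 < relative_entropy c a"
proof -
  have T: "0 < total a" unfolding total_def using a by (intro sum_pos) auto
  have zero: "(\<Sum>i\<in>UNIV. a $ i - total a * c $ i) = 0"
    using c(2) by (simp add: sum_subtractf total_def flip: sum_distrib_left)
  have le: "a $ i - total a * c $ i \<le> a $ i * (ln (a $ i) - ln (total a * c $ i))" for i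
    using a c T by (intro ln_quotient_bound) auto
  show "0 \<le> relative_entropy c a"
    unfolding relative_entropy_def zero[symmetric] by (intro sum_mono le)
  assume "a \<noteq> total a *\<^sub>R c"
  then obtain j where "a $ j \<noteq> total a * c $ j" by (auto simp: vec_eq_iff)
  then have "a $ j - total a * c $ j < a $ j * (ln (a $ j) - ln (total a * c $ j))"
    using a c T by (intro ln_quotient_bound) auto
  then show "0 < relative_entropy c a"
    unfolding relative_entropy_def zero[symmetric] by (intro sum_strict_mono_ex1) (use le in auto)
qed

text \<open>
  By homogeneity, differentiating the logarithms contributes nothing: these terms are
  \<open>h\<^sub>i - a\<^sub>i total h / total a\<close>, with sum 0.
\<close>

lemma relative_entropy_has_derivative:
  assumes a: "\<And>i. 0 < a $ i" and c: "\<And>i. 0 < c $ i"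
  shows "(relative_entropy c has_derivative
    (\<lambda>h. \<Sum>i\<in>UNIV. h $ i * (ln (a $ i) - ln (total a * c $ i)))) (at a)"
proof -
  have T: "0 < total a" unfolding total_def using a by (intro sum_pos) auto
  have dn: "((\<lambda>a. a $ i) has_derivative (\<lambda>h. h $ i)) (at a)" for i
    by (rule bounded_linear_imp_has_derivative[OF bounded_linear_vec_nth])
  have dt: "(total has_derivative total) (at a)"
    by (rule bounded_linear_imp_has_derivative[OF bounded_linear_total])
  have "((\<lambda>a. a $ i * (ln (a $ i) - ln (total a * c $ i))) has_derivative
      (\<lambda>h. h $ i * (ln (a $ i) - ln (total a * c $ i)) + (h $ i - a $ i * (total h / total a)))) (at a)"
    for i
  proof -
    have pos: "0 < a $ i" "0 < total a * c $ i"
      using a[of i] c[of i] T by auto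
    show ?thesis
      by (rule has_derivative_eq_rhs[OF has_derivative_mult[OF dn has_derivative_diff[
              OF has_derivative_ln[OF pos(1) dn]
                has_derivative_ln[OF pos(2) has_derivative_mult_left[OF dt]]]]])
         (use a[of i] c[of i] T in \<open>simp add: fun_eq_iff algebra_simps inverse_eq_divide\<close>)
  qed
  then have "(relative_entropy c has_derivative (\<lambda>h. \<Sum>i\<in>UNIV.
      h $ i * (ln (a $ i) - ln (total a * c $ i)) + (h $ i - a $ i * (total h / total a)))) (at a)"
    unfolding relative_entropy_def by (intro has_derivative_sum) auto
  moreover have "(\<Sum>i\<in>UNIV. h $ i - a $ i * (total h / total a)) = 0" for h
  proof -
    have "(\<Sum>i\<in>UNIV. a $ i * (total h / total a)) = total a * (total h / total a)"
      by (simp only: total_def sum_distrib_right)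
    then show ?thesis using T by (simp add: sum_subtractf flip: total_def)
  qed
  ultimately show ?thesis by (simp add: sum.distrib)
qed

section \<open>The dynamics as an equation for the solid masses\<close>

lemma total_between:
  assumes "m \<in> box 0 m0" "total m0 = 1"
  shows "0 < total m" "total m < 1"
proof -
  show "0 < total m"
    using assms(1) unfolding total_def by (intro sum_pos) (auto simp: mem_box_cart)
  have "total m < total m0"
    using assms(1) unfolding total_def by (intro sum_strict_mono) (auto simp: mem_box_cart)
  then show "total m < 1" using assms(2) by simp
qed

text \<open>
  The bounds on \<open>X\<close> follow from those on the masses, so the state space is the graph of \<open>total\<close>
  over an open box.
\<close>

lemma state_space_graph:
  assumes "total m0 = 1"
  shows "z \<in> state_space m0 \<longleftrightarrow> fst z \<in> box 0 m0 \<and> snd z = total (fst z)"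
  using total_between[of "fst z" m0] assms
  by (cases z) (auto simp: state_space_def mem_box_cart total_def)

lemma solution_imp_ode_solution:
  assumes "total m0 = 1" "solution b m0 z I"
  shows "ode_solution (\<lambda>m. velocity b m0 (m, total m)) (\<lambda>t. fst (z t)) I"
proof -
  have "z t = (fst (z t), total (fst (z t)))" if "t \<in> I" for t
    using assms(2) that
    by (auto simp: solution_def state_space_graph[OF assms(1)] prod_eq_iff)
  then show ?thesis
    using assms(2) by (auto simp: solution_def ode_solution_def)
qed

lemma ode_solution_imp_solution:
  assumes "total m0 = 1" "ode_solution (\<lambda>m. velocity b m0 (m, total m)) y I" "y ` I \<subseteq> box 0 m0"
  shows "solution b m0 (\<lambda>t. (y t, total (y t))) I"
  using assms by (auto simp: solution_def ode_solution_def state_space_graph)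

lemma velocity_nth:
  "velocity b m0 (m, X) $ i =
    sqrt (b $ i) * ((m0 $ i - m $ i) / (1 - X)) - 1 / sqrt (b $ i) * (m $ i / X)"
  by (simp add: velocity_def flux_def)

lemma velocity_lipschitz:
  assumes "compact S" "S \<subseteq> box 0 m0" "total m0 = 1"
  shows "\<exists>L. L-lipschitz_on S (\<lambda>m. velocity b m0 (m, total m))"
proof (rule lipschitz_on_vec)
  fix i
  obtain Lt where Lt: "Lt-lipschitz_on S total"
    using bounded_linear.lipschitz_boundE[OF bounded_linear_total] by blast
  obtain Ln where Ln: "Ln-lipschitz_on S (\<lambda>m. m $ i)"
    using bounded_linear.lipschitz_boundE[OF bounded_linear_vec_nth] by blast
  have pos: "0 < total m" "0 < 1 - total m" if "m \<in> S" for m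
    using total_between[of m m0] assms that by auto
  obtain L1 where L1: "L1-lipschitz_on S (\<lambda>m. (m0 $ i - m $ i) / (1 - total m))"
    using lipschitz_on_divide_compact[OF assms(1)
        lipschitz_on_diff[OF lipschitz_on_constant Ln] lipschitz_on_diff[OF lipschitz_on_constant Lt]]
      pos by blast
  obtain L2 where L2: "L2-lipschitz_on S (\<lambda>m. m $ i / total m)"
    using lipschitz_on_divide_compact[OF assms(1) Ln Lt] pos by blast
  show "\<exists>L. L-lipschitz_on S (\<lambda>m. velocity b m0 (m, total m) $ i)"
    unfolding velocity_nth
    using lipschitz_on_diff[OF lipschitz_on_cmult_real[OF L1] lipschitz_on_cmult_real[OF L2]]
    by blast
qed

section \<open>The free energy as a Lyapunov function\<close>

text \<open>
  Relative to the compositions \<open>cs\<close> and \<open>cg\<close>. If these are the compositions of a stationary state,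
  this is the thermodynamic free energy minus its value there: equality of the chemical potentials
  in both phases makes the linear part of the difference vanish.
\<close>

definition free_energy :: "real^'n \<Rightarrow> real^'n \<Rightarrow> real^'n \<Rightarrow> real^'n \<Rightarrow> real" where
  "free_energy cs cg m0 m = relative_entropy cs m + relative_entropy cg (m0 - m)"

lemma free_energy_has_derivative:
  assumes m: "m \<in> box 0 m0" and pos: "\<And>i. 0 < cs $ i" "\<And>i. 0 < cg $ i" and "total m0 = 1"
  shows "(free_energy cs cg m0 has_derivative (\<lambda>h. \<Sum>i\<in>UNIV. h $ i *
    ((ln (m $ i) - ln (total m * cs $ i)) - (ln (m0 $ i - m $ i) - ln ((1 - total m) * cg $ i))))) (at m)"
proof -
  have g: "((\<lambda>m. relative_entropy cg (m0 - m)) has_derivative (\<lambda>h. \<Sum>i\<in>UNIV. (- h) $ i *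
    (ln ((m0 - m) $ i) - ln (total (m0 - m) * cg $ i)))) (at m)"
    using m pos
    by (intro has_derivative_compose[OF _ relative_entropy_has_derivative])
       (auto intro!: derivative_eq_intros simp: mem_box_cart)
  show ?thesis
    unfolding free_energy_def
    using m pos \<open>total m0 = 1\<close>
    by (auto intro!: has_derivative_eq_rhs[OF has_derivative_add[OF relative_entropy_has_derivative g]]
        simp: mem_box_cart fun_eq_iff right_diff_distrib sum_subtractf sum_negf)
qed

text \<open>
  With \<open>x = c\<^sup>s\<^sub>i\<close> and \<open>y = \<beta>\<^sub>i c\<^sup>g\<^sub>i\<close>, each summand is \<open>(y - x) (ln x - ln y)\<close> divided by the square
  root of \<open>\<beta>\<^sub>i\<close>. The stationary compositions enter only through their ratio \<open>\<beta>\<^sub>i\<close>.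
\<close>

lemma free_energy_dissipation:
  assumes m: "m \<in> box 0 m0" and "total m0 = 1"
    and b: "\<And>i. 0 < b $ i" and cg: "\<And>i. 0 < cg $ i" and cs: "\<And>i. cs $ i = b $ i * cg $ i"
  shows "(\<Sum>i\<in>UNIV. velocity b m0 (m, total m) $ i *
    ((ln (m $ i) - ln (total m * cs $ i)) - (ln (m0 $ i - m $ i) - ln ((1 - total m) * cg $ i)))) \<le> 0"
proof (rule sum_nonpos)
  fix i
  note T = total_between[OF m \<open>total m0 = 1\<close>]
  have mi: "0 < m $ i" "0 < m0 $ i - m $ i" using m by (auto simp: mem_box_cart)
  define x where "x = m $ i / total m"
  define y where "y = b $ i * ((m0 $ i - m $ i) / (1 - total m))"
  have xy: "0 < x" "0 < y" using T mi b[of i] by (auto simp: x_def y_def)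
  have "velocity b m0 (m, total m) $ i = (y - x) / sqrt (b $ i)"
    unfolding velocity_nth x_def[symmetric] y_def using b[of i]
    by (simp add: field_simps flip: power2_eq_square)
  moreover have "(ln (m $ i) - ln (total m * cs $ i))
      - (ln (m0 $ i - m $ i) - ln ((1 - total m) * cg $ i)) = ln x - ln y"
    unfolding x_def y_def cs using T mi b[of i] cg[of i]
    by (simp add: ln_mult ln_div)
  moreover have "(y - x) * (ln x - ln y) \<le> 0"
    using xy by (cases "x \<le> y") (auto simp: mult_nonneg_nonpos mult_nonpos_nonneg)
  ultimately show "velocity b m0 (m, total m) $ i *
      ((ln (m $ i) - ln (total m * cs $ i)) - (ln (m0 $ i - m $ i) - ln ((1 - total m) * cg $ i))) \<le> 0"
    using b[of i] by (simp add: divide_nonpos_pos)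
qed

text \<open>
  The free energy vanishes at the stationary state. Both relative entropies vanish at \<open>m\<close> only if \<open>m\<close>
  and \<open>m0 - m\<close> are multiples of \<open>cs\<close> and \<open>cg\<close>; then \<open>m0\<close> is the mixture of \<open>cs\<close> and \<open>cg\<close> with
  proportion \<open>total m\<close> as well as with proportion \<open>X\<close>, and \<open>cs \<noteq> cg\<close> makes these equal.
\<close>

lemma free_energy_strict_min:
  assumes m: "m \<in> box 0 m0" and "total m0 = 1"
    and cs: "\<And>i. 0 < cs $ i" "total cs = 1" and cg: "\<And>i. 0 < cg $ i" "total cg = 1"
    and bal: "m0 = X *\<^sub>R cs + (1 - X) *\<^sub>R cg" and "cs \<noteq> cg"
    and "m \<noteq> X *\<^sub>R cs"
  shows "free_energy cs cg m0 (X *\<^sub>R cs) < free_energy cs cg m0 m"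
proof -
  have "m0 - X *\<^sub>R cs = (1 - X) *\<^sub>R cg" using bal by simp
  then have "free_energy cs cg m0 (X *\<^sub>R cs) = 0"
    by (simp add: free_energy_def relative_entropy_multiple cs cg)
  moreover have "0 < free_energy cs cg m0 m"
  proof (cases "m = total m *\<^sub>R cs \<and> m0 - m = total (m0 - m) *\<^sub>R cg")
    case True
    then have "m = total m *\<^sub>R cs" "m0 - m = (1 - total m) *\<^sub>R cg"
      using \<open>total m0 = 1\<close> by auto
    then have "m0 = total m *\<^sub>R cs + (1 - total m) *\<^sub>R cg"
      by (metis add.commute diff_add_cancel)
    with bal have "(total m - X) *\<^sub>R (cs - cg) = 0"
      by (simp add: algebra_simps)
    then have "total m = X" using \<open>cs \<noteq> cg\<close> by simp
    then show ?thesis using True \<open>m \<noteq> X *\<^sub>R cs\<close> by simp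
  next
    case False
    have "\<And>i. 0 < m $ i" "\<And>i. 0 < (m0 - m) $ i" using m by (auto simp: mem_box_cart)
    then show ?thesis
      using False relative_entropy_pos[of m cs] relative_entropy_pos[of "m0 - m" cg] cs cg
      unfolding free_energy_def by fastforce
  qed
  ultimately show ?thesis by simp
qed

text \<open>
  The compositions are only assumed to be nonnegative; positivity, without which the logarithms
  would be meaningless, comes from the positive total mass of each species.
\<close>

lemma nontrivial_stationary_positive:
  assumes st: "nontrivial_stationary b m0 cs cg X" and b: "\<And>i. 0 < b $ i" and m0: "\<And>i. 0 < m0 $ i"
  shows "cs $ i = b $ i * cg $ i" "0 < cg $ i" "0 < cs $ i"
proof -
  from st have X: "0 < X" "X < 1" and bal: "X * cs $ i + (1 - X) * cg $ i = m0 $ i"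
    and fl: "sqrt (b $ i) * cg $ i - 1 / sqrt (b $ i) * cs $ i = 0"
    by (auto simp: nontrivial_stationary_def flux_def)
  show cs: "cs $ i = b $ i * cg $ i"
    using fl b[of i] by (simp add: field_simps flip: power2_eq_square)
  have "0 < cg $ i * (X * b $ i + (1 - X))"
    using bal m0[of i] unfolding cs by (simp add: algebra_simps)
  moreover have "0 < X * b $ i + (1 - X)"
    using X b[of i] by (simp add: add_pos_pos)
  ultimately show "0 < cg $ i" by (simp add: zero_less_mult_iff)
  then show "0 < cs $ i" using cs b[of i] by simp
qed

section \<open>Stability of the non-trivial stationary state\<close>

theorem proposition2:
  fixes mu_s mu_g m0 cs cg :: "real^'n" and X :: real
  assumes "m0 \<in> concentrations"
    and "\<forall>i. 0 < m0 $ i"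
    and "\<exists>i. beta mu_s mu_g $ i \<noteq> 1"
    and "min (\<Sum>i\<in>UNIV. m0 $ i * beta mu_s mu_g $ i)
             (\<Sum>i\<in>UNIV. m0 $ i / beta mu_s mu_g $ i) > 1"
    and "nontrivial_stationary (beta mu_s mu_g) m0 cs cg X"
  shows "(X *\<^sub>R cs, X) \<in> state_space m0 \<and>
    lyapunov_stable (solution (beta mu_s mu_g) m0) (state_space m0) (X *\<^sub>R cs, X)"
proof -
  define b where "b = beta mu_s mu_g"
  define p where "p = X *\<^sub>R cs"
  define f where "f = (\<lambda>m. velocity b m0 (m, total m))"
  note stat = assms(5)[folded b_def]
  have b: "0 < b $ i" for i by (simp add: b_def beta_def)
  have m0: "total m0 = 1" using assms(1) by (simp add: concentrations_def total_def)
  note eq = nontrivial_stationary_positive(1)[OF stat b assms(2)[rule_format]]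
    and cg = nontrivial_stationary_positive(2)[OF stat b assms(2)[rule_format]]
    and cs = nontrivial_stationary_positive(3)[OF stat b assms(2)[rule_format]]
  have tcs: "total cs = 1" and tcg: "total cg = 1" and X: "0 < X" "X < 1"
    and bal: "m0 = X *\<^sub>R cs + (1 - X) *\<^sub>R cg"
    using stat by (auto simp: nontrivial_stationary_def concentrations_def total_def vec_eq_iff)
  obtain j where "b $ j \<noteq> 1" using assms(3) by (auto simp: b_def)
  then have "cs \<noteq> cg" using eq[of j] cg[of j] by auto
  have p_box: "p \<in> box 0 m0"
    using X cs cg by (auto simp: mem_box_cart p_def bal)
  have "total p = X" using tcs by (simp add: p_def)
  have "(p, X) \<in> state_space m0"
    using p_box \<open>total p = X\<close> by (simp add: state_space_graph[OF m0])
  moreover have "lyapunov_stable (solution b m0) (state_space m0) (p, X)"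
    unfolding lyapunov_stable_def
  proof (intro allI impI)
    fix U assume "neighbourhood_in (state_space m0) (p, X) U"
    then obtain A where "open A" "(p, X) \<in> A" and A: "state_space m0 \<inter> A \<subseteq> U"
      unfolding neighbourhood_in_def openin_open by blast
    define B where "B = box 0 m0 \<inter> (\<lambda>m. (m, total m)) -` A"
    have "continuous_on (box 0 m0) (\<lambda>m. (m, total m))"
      by (intro continuous_intros linear_continuous_on bounded_linear_total)
    then have "open B"
      unfolding B_def using \<open>open A\<close> by (intro continuous_open_preimage open_box)
    moreover have "p \<in> B"
      using p_box \<open>(p, X) \<in> A\<close> \<open>total p = X\<close> by (simp add: B_def)
    ultimately obtain r where r: "0 < r" and rB: "cball p r \<subseteq> B"
      by (auto simp: open_contains_cball)
    then have r_box: "cball p r \<subseteq> box 0 m0" by (auto simp: B_def)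
    have to_U: "z \<in> U" if "z \<in> state_space m0" "fst z \<in> ball p r" for z
    proof -
      have "fst z \<in> B" using that(2) rB by (auto simp: less_imp_le)
      then show ?thesis
        using that(1) A by (cases z) (auto simp: B_def state_space_graph[OF m0])
    qed
    obtain L where L: "L-lipschitz_on (cball p r) f"
      unfolding f_def using velocity_lipschitz[OF compact_cball r_box m0] by blast
    obtain N where N: "open N" "p \<in> N"
      and exist: "\<And>x. x \<in> N \<Longrightarrow> \<exists>y. ode_solution f y {0..} \<and> y 0 = x"
      and trapped: "\<And>z I. ode_solution f z I \<Longrightarrow> z 0 \<in> N \<Longrightarrow> z ` I \<subseteq> ball p r"
    proof (rule lyapunov_trapping_neighbourhood[OF r L])
      fix x assume "x \<in> cball p r"
      then have x: "x \<in> box 0 m0" using r_box by blast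
      show "(free_energy cs cg m0 has_derivative (\<lambda>h. \<Sum>i\<in>UNIV. h $ i *
        ((ln (x $ i) - ln (total x * cs $ i))
          - (ln (m0 $ i - x $ i) - ln ((1 - total x) * cg $ i))))) (at x)"
        by (rule free_energy_has_derivative[OF x cs cg m0])
      show "(\<Sum>i\<in>UNIV. f x $ i * ((ln (x $ i) - ln (total x * cs $ i))
          - (ln (m0 $ i - x $ i) - ln ((1 - total x) * cg $ i)))) \<le> 0"
        unfolding f_def by (rule free_energy_dissipation[OF x m0 b cg eq])
      show "free_energy cs cg m0 p < free_energy cs cg m0 x" if "x \<noteq> p"
        using that unfolding p_def
        by (rule free_energy_strict_min[OF x m0 cs tcs cg tcg bal \<open>cs \<noteq> cg\<close>])
    qed (rule that)
    note project = solution_imp_ode_solution[OF m0, of b, folded f_def]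
    have lift: "\<exists>y. solution b m0 y {0..} \<and> y 0 = x" if x: "x \<in> state_space m0" "fst x \<in> N" for x
    proof -
      obtain y where y: "ode_solution f y {0..}" "y 0 = fst x"
        using exist[OF x(2)] by blast
      have "y ` {0..} \<subseteq> box 0 m0"
        using trapped[OF y(1)] y(2) x(2) r_box ball_subset_cball by (metis subset_trans)
      then have "solution b m0 (\<lambda>t. (y t, total (y t))) {0..}"
        by (rule ode_solution_imp_solution[OF m0 y(1)[unfolded f_def]])
      moreover have "(y 0, total (y 0)) = x"
        using x(1) y(2) by (simp add: state_space_graph[OF m0] prod_eq_iff)
      ultimately show ?thesis by (intro exI[of _ "\<lambda>t. (y t, total (y t))"]) simp
    qed
    define V where "V = state_space m0 \<inter> N \<times> UNIV"
    have V: "x \<in> V \<longleftrightarrow> x \<in> state_space m0 \<and> fst x \<in> N" for x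
      by (cases x) (auto simp: V_def)
    have nbhd: "neighbourhood_in (state_space m0) (p, X) V"
      unfolding neighbourhood_in_def
      using N \<open>(p, X) \<in> state_space m0\<close>
      by (intro conjI exI[of _ V]) (auto simp: V_def intro!: openin_open_Int open_Times)
    \<comment> \<open>A maximal solution from \<open>V\<close> agrees with a global one on its interval, hence has no smaller
      interval.\<close>
    have stay: "I = {0..} \<and> (\<forall>t\<in>I. z t \<in> U)"
      if x: "x \<in> V" and max: "maximal_solution (solution b m0) z I" and z0: "z 0 = x" for x z I
    proof -
      have sol: "solution b m0 z I" using max by (simp add: maximal_solution_def)
      note zf = project[OF sol]
      have start: "fst (z 0) \<in> N" using x z0 by (simp add: V)
      have space: "z t \<in> state_space m0" if "t \<in> I" for t
        using sol that by (simp add: solution_def)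
      have "fst (z t) \<in> ball p r" if "t \<in> I" for t
        using trapped[OF zf start] that by auto
      then have zU: "\<forall>t\<in>I. z t \<in> U" using to_U space by blast
      obtain y where y: "solution b m0 y {0..}" "y 0 = x" using lift x V by blast
      have I0: "is_interval I" "0 \<in> I" "I \<subseteq> {0..}" using sol by (auto simp: solution_def)
      have yf: "ode_solution f (\<lambda>t. fst (y t)) I"
        by (rule ode_solution_restrict[OF project[OF y(1)] I0])
      have y_start: "fst (y 0) \<in> N" and same: "fst (y 0) = fst (z 0)"
        using start y(2) z0 by simp_all
      have "y t = z t" if t: "t \<in> I" for t
      proof -
        note seg = ode_solution_initial_segment[OF _ t]
        have "(\<lambda>t. fst (y t)) ` {0..t} \<subseteq> cball p r" "(\<lambda>t. fst (z t)) ` {0..t} \<subseteq> cball p r"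
          using trapped[OF seg(1)[OF yf] y_start] trapped[OF seg(1)[OF zf] start] ball_subset_cball
          by blast+
        then have "fst (y t) = fst (z t)"
          using lipschitz_ode_unique[where y = "\<lambda>t. fst (y t)" and z = "\<lambda>t. fst (z t)" and T = t, OF L]
            seg(1,2)[OF zf] seg(1)[OF yf] same by blast
        moreover have "y t \<in> state_space m0" using y(1) t I0(3) by (auto simp: solution_def)
        ultimately show ?thesis
          using space[OF t] by (simp add: state_space_graph[OF m0] prod_eq_iff)
      qed
      then have "I = {0..}"
        using max y(1) I0(3) unfolding maximal_solution_def by blast
      then show ?thesis using zU by blast
    qed
    show "\<exists>V. neighbourhood_in (state_space m0) (p, X) V \<and>
         (\<forall>x\<in>V. (\<exists>z. solution b m0 z {0..} \<and> z 0 = x) \<and>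
           (\<forall>z I. maximal_solution (solution b m0) z I \<and> z 0 = x \<longrightarrow>
              I = {0..} \<and> (\<forall>t\<in>I. z t \<in> U)))"
      using nbhd stay lift V by blast
  qed
  ultimately show ?thesis by (simp add: p_def b_def)
qed

end
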